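(* Let $N\ge 2$, $1\le M<N$, let $a\in\mathbb{R}_+^N$ and let $b:\mathbb{R}_+^N\times\mathbb{R}_+^N\to\mathbb{R}_+^N$ be a bilinear form such that $e=a+b(e,e)$. Let $x^\ast$ be the minimal nonnegative solution of the quadratic vector equation $$x=a+b(x,x),\qquad x\in\mathbb{R}_+^N, \qquad (\mathrm{QVE})$$ and suppose that $x^\ast>0$ (all entries strictly positive). Suppose that the matrix $R=b(e,\cdot)+b(\cdot,e)$ has the block form $$R=\begin{bmatrix}R_{11}&R_{12}\\ 0&R_{22}\end{bmatrix},$$ where $R_{11}$ is $M\times M$ and $R_{22}$ is $(N-M)\times(N-M)$. Partition accordingly $$x=\begin{bmatrix}x_1\\ x_2\end{bmatrix},\qquad x^\ast=\begin{bmatrix}x_1^\ast\\ x_2^\ast\end{bmatrix},\qquad a=\begin{bmatrix}a_1\\ a_2\end{bmatrix}.$$ Let $P=\begin{bmatrix}I_M&0_{M\times(N-M)}\end{bmatrix}$ and $Q=\begin{bmatrix}0_{(N-M)\times M}&I_{N-M}\end{bmatrix}$. Define the bilinear form on $\mathbb{R}_+^{N-M}$ $$b_2(u,v):=Qb(Q^Tu,Q^Tv).$$ For $y\in\mathbb{R}_+^{N-M}$ define $$T_y:=I_M-Pb(\cdot,Q^Ty)P^T-Pb(Q^Ty,\cdot)P^T,$$ and, when $T_y$ is nonsingular, $$a_y:=T_y^{-1}\bigl(a_1+Pb(Q^Ty,Q^Ty)\bigr),\qquad b_y(u,v):=T_y^{-1}Pb(P^Tu,P^Tv)\quad(u,v\in\mathbb{R}_+^M).$$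 Then: 1. A vector $x\in\mathbb{R}_+^N$ solves (QVE) if and only if $T_{x_2}$ is nonsingular and its block components $x_2$ and $x_1$ solve respectively the two quadratic vector equations $$x_2=a_2+b_2(x_2,x_2)\qquad\text{and}\qquad x_1=a_{x_2}+b_{x_2}(x_1,x_1).$$ 2. The block $x_2^\ast$ of the minimal solution $x^\ast$ of (QVE) is the minimal nonnegative solution of $x_2=a_2+b_2(x_2,x_2)$, and the block $x_1^\ast$ is the minimal nonnegative solution of $x_1=a_{x_2^\ast}+b_{x_2^\ast}(x_1,x_1)$.
   Context: $\mathbb{R}_+^N=\{v\in\mathbb{R}^N: v_i\ge 0,\ i=1,\dots,N\}$; $e=(1,1,\dots,1)^T$. Vector inequalities are componentwise. A bilinear form $b:\mathbb{R}_+^N\times\mathbb{R}_+^N\to\mathbb{R}_+^N$ is given by nonnegative coefficients $b_{ijk}=e_i^Tb(e_j,e_k)\ge0$ (with $e_\ell$ the $\ell$-th canonical basis vector) via $(b(x,y))_i=\sum_{j,k}b_{ijk}x_jy_k$; it need not be symmetric. For fixed $y,z$, $b(y,\cdot)$ and $b(\cdot,z)$ denote the $N\times N$ matrices of the linear maps $v\mapsto b(y,v)$ and $v\mapsto b(v,z)$. The minimal nonnegative solution of a quadratic vector equation is the nonnegative solution that is componentwise less than or equal to every other nonnegative solution. For the equation $x=a+b(x,x)$ considered here, which has the nonnegative solution $e$, it is known to exist. *)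

theory Defs
  imports "HOL-Analysis.Analysis"
begin

text \<open>
  The index set of the ambient space is a disjoint sum \<open>'m + 'n\<close>: \<open>Inl\<close> indexes the first block
  (dimension \<open>M = CARD('m)\<close>), \<open>Inr\<close> the second (dimension \<open>N - M = CARD('n)\<close>). As types are
  nonempty, \<open>1 \<le> M < N\<close> and \<open>N \<ge> 2\<close> hold automatically. The order \<open>\<le>\<close> on vectors is the
  componentwise one of the library, and \<open>1\<close> is the all-ones vector.
\<close>

text \<open>
  A bilinear form on the nonnegative orthant is represented by its bilinear extension to the
  whole space; nonnegativity is that of the coefficients \<open>b\<^sub>i\<^sub>j\<^sub>k = b (e\<^sub>j, e\<^sub>k)\<^sub>i\<close>.
\<close>

definition nonneg_bilinear :: "(real^'k::finite \<Rightarrow> real^'k \<Rightarrow> real^'k) \<Rightarrow> bool" where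
  "nonneg_bilinear b \<longleftrightarrow> bilinear b \<and> (\<forall>i j k. 0 \<le> b (axis j 1) (axis k 1) $ i)"

definition qve_solution :: "real^'k::finite \<Rightarrow> (real^'k \<Rightarrow> real^'k \<Rightarrow> real^'k) \<Rightarrow> real^'k \<Rightarrow> bool" where
  "qve_solution a b x \<longleftrightarrow> 0 \<le> x \<and> x = a + b x x"

definition minimal_qve_solution ::
    "real^'k::finite \<Rightarrow> (real^'k \<Rightarrow> real^'k \<Rightarrow> real^'k) \<Rightarrow> real^'k \<Rightarrow> bool" where
  "minimal_qve_solution a b x \<longleftrightarrow>
     qve_solution a b x \<and> (\<forall>y. qve_solution a b y \<longrightarrow> x \<le> y)"

definition R_mat :: "(real^'k::finite \<Rightarrow> real^'k \<Rightarrow> real^'k) \<Rightarrow> real^'k^'k" where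
  "R_mat b = matrix (\<lambda>v. b 1 v) + matrix (\<lambda>v. b v 1)"

definition P_mat :: "real^('m::finite + 'n::finite)^'m" where
  "P_mat = (\<chi> i j. if j = Inl i then 1 else 0)"

definition Q_mat :: "real^('m::finite + 'n::finite)^'n" where
  "Q_mat = (\<chi> i j. if j = Inr i then 1 else 0)"

definition b2_form ::
    "(real^('m::finite + 'n::finite) \<Rightarrow> real^('m + 'n) \<Rightarrow> real^('m + 'n)) \<Rightarrow> real^'n \<Rightarrow> real^'n \<Rightarrow> real^'n" where
  "b2_form b u v = Q_mat *v b (transpose Q_mat *v u) (transpose Q_mat *v v)"

definition T_mat ::
    "(real^('m::finite + 'n::finite) \<Rightarrow> real^('m + 'n) \<Rightarrow> real^('m + 'n)) \<Rightarrow> real^'n \<Rightarrow> real^'m^'m" where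
  "T_mat b y = mat 1
     - P_mat ** matrix (\<lambda>v. b v (transpose Q_mat *v y)) ** transpose P_mat
     - P_mat ** matrix (\<lambda>v. b (transpose Q_mat *v y) v) ** transpose P_mat"

text \<open>The next two are meaningful only if \<open>T_mat b y\<close> is invertible.\<close>

definition a_red ::
    "real^('m::finite + 'n::finite) \<Rightarrow> (real^('m + 'n) \<Rightarrow> real^('m + 'n) \<Rightarrow> real^('m + 'n)) \<Rightarrow> real^'n \<Rightarrow> real^'m" where
  "a_red a b y = matrix_inv (T_mat b y) *v
     (P_mat *v a + P_mat *v b (transpose Q_mat *v y) (transpose Q_mat *v y))"

definition b_red ::
    "(real^('m::finite + 'n::finite) \<Rightarrow> real^('m + 'n) \<Rightarrow> real^('m + 'n)) \<Rightarrow> real^'n \<Rightarrow>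
     real^'m \<Rightarrow> real^'m \<Rightarrow> real^'m" where
  "b_red b y u v = matrix_inv (T_mat b y) *v
     (P_mat *v b (transpose P_mat *v u) (transpose P_mat *v v))"

end

theory Submission
  imports Defs
begin

text \<open>
  Two facts about the monotone map \<open>x \<mapsto> a + b x x\<close> carry the proof.

  First, the minimal solution lies below every nonnegative vector \<open>y\<close> with \<open>a + b y y \<le> y\<close>
  (\<open>minimal_qve_solution_le_supersolution\<close>, a Knaster--Tarski argument). So minimality can be
  tested against inequalities, which survive operations that destroy the equation: truncating at
  \<open>1\<close>, or setting some coordinates to zero.

  Second, the zero block of \<open>R\<close> means that no coefficient of \<open>b\<close> in the second block of rows involves
  a first-block variable (\<open>second_block_closed\<close>). Hence the equation for \<open>x\<^sub>2\<close> is autonomous, and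
  sorting the terms of the first block by degree in \<open>x\<^sub>1\<close> turns the remaining equation into
  \<open>T x\<^sub>1 = a\<^sub>1 + P b(Q\<^sup>T x\<^sub>2, Q\<^sup>T x\<^sub>2) + P b(P\<^sup>T x\<^sub>1, P\<^sup>T x\<^sub>1)\<close>, where \<open>T\<close> is \<open>T_mat b x\<^sub>2\<close>.
  All of part 1 is then formal, except that a solution must force \<open>T\<close> to be invertible.

  For that, write \<open>T = I - K\<close> with \<open>K \<ge> 0\<close>. A solution satisfies \<open>x \<ge> x\<^sup>* > 0\<close>, so \<open>x\<^sub>1\<close> is a
  positive vector with \<open>K x\<^sub>1 \<le> x\<^sub>1\<close>. If \<open>T\<close> were singular, the indices at which a kernel vector
  is largest relative to \<open>x\<^sub>1\<close> would form a nonempty set \<open>S\<close> on which the right-hand side above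
  vanishes and whose rows of \<open>K\<close> involve only \<open>S\<close> (\<open>singular_imp_closed_index_set\<close>). Setting
  the \<open>S\<close>-coordinates of \<open>x\<close> to zero then leaves a vector \<open>y\<close> with \<open>a + b y y \<le> y\<close>, so \<open>x\<^sup>*\<close>
  would vanish on \<open>S\<close>, contrary to \<open>x\<^sup>* > 0\<close>.

  In part 2, a solution \<open>v\<close> of the autonomous equation need not extend to a solution of the full
  one, but \<open>(1, min 1 v)\<close> is a supersolution because \<open>1\<close> solves the full equation; thus
  \<open>x\<^sub>2\<^sup>* \<le> v\<close>. Minimality of \<open>x\<^sub>1\<^sup>*\<close> follows by gluing a competitor to \<open>x\<^sub>2\<^sup>*\<close> by means of part 1.
\<close>

section \<open>Nonnegative bilinear forms and supersolutions\<close>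

lemma bilinear_coordinates:
  fixes b :: "real^'k::finite \<Rightarrow> real^'k \<Rightarrow> real^'k"
  assumes "bilinear b"
  shows "b x y $ i = (\<Sum>j\<in>UNIV. \<Sum>k\<in>UNIV. x $ j * y $ k * b (axis j 1) (axis k 1) $ i)"
proof -
  have "b x y = b (\<Sum>j\<in>UNIV. x $ j *\<^sub>R axis j 1) (\<Sum>k\<in>UNIV. y $ k *\<^sub>R axis k 1)"
    using basis_expansion[of x] basis_expansion[of y] by (simp add: scalar_mult_eq_scaleR)
  also have "\<dots> = (\<Sum>j\<in>UNIV. \<Sum>k\<in>UNIV. (x $ j * y $ k) *\<^sub>R b (axis j 1) (axis k 1))"
    by (simp add: bilinear_sum[OF assms] sum.cartesian_product bilinear_lmul[OF assms]
        bilinear_rmul[OF assms] mult.commute)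
  finally show ?thesis by simp
qed

lemma nonneg_bilinearD: "nonneg_bilinear b \<Longrightarrow> bilinear b"
  by (simp add: nonneg_bilinear_def)

lemma nonneg_bilinear_nonneg:
  assumes b: "nonneg_bilinear b" and x: "0 \<le> x" and y: "0 \<le> y"
  shows "0 \<le> b x y"
proof -
  have "0 \<le> x $ j" "0 \<le> y $ k" "0 \<le> b (axis j 1) (axis k 1) $ i" for i j k
    using assms by (auto simp: less_eq_vec_def nonneg_bilinear_def)
  then have "0 \<le> b x y $ i" for i
    by (subst bilinear_coordinates[OF nonneg_bilinearD[OF b]]) (simp add: sum_nonneg)
  then show ?thesis by (simp add: less_eq_vec_def)
qed

lemma nonneg_bilinear_mono:
  assumes b: "nonneg_bilinear b" and "0 \<le> x" "x \<le> x'" "0 \<le> y" "y \<le> y'"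
  shows "b x y \<le> b x' y'"
proof -
  have "0 \<le> b (x' - x) y'" "0 \<le> b x (y' - y)"
    using assms by (auto intro!: nonneg_bilinear_nonneg[OF b] intro: order_trans[of 0 y y'])
  then show ?thesis
    by (simp add: bilinear_lsub[OF nonneg_bilinearD[OF b]] bilinear_rsub[OF nonneg_bilinearD[OF b]])
qed

text \<open>
  The componentwise infimum of all nonnegative supersolutions is again one, by monotonicity; so is
  its image under \<open>x \<mapsto> a + b x x\<close>, which makes it a solution.
\<close>
lemma minimal_qve_solution_le_supersolution:
  fixes a y :: "real^'k::finite"
  assumes a: "0 \<le> a" and b: "nonneg_bilinear b" and m: "minimal_qve_solution a b m"
    and y: "0 \<le> y" "a + b y y \<le> y"
  shows "m \<le> y"
proof -
  define S where "S = {v. 0 \<le> v \<and> a + b v v \<le> v}"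
  define z where "z = (\<chi> i. Inf ((\<lambda>v. v $ i) ` S))"
  have bdd: "bdd_below ((\<lambda>v. v $ i) ` S)" for i
    by (rule bdd_belowI[of _ 0]) (auto simp: S_def less_eq_vec_def)
  have yS: "y \<in> S" using y by (simp add: S_def)
  have lower: "z \<le> v" if "v \<in> S" for v
    using that bdd by (auto simp: less_eq_vec_def z_def intro!: cInf_lower)
  have greatest: "u \<le> z" if "\<And>v. v \<in> S \<Longrightarrow> u \<le> v" for u
    unfolding less_eq_vec_def z_def using that yS
    by (auto simp: less_eq_vec_def intro!: cInf_greatest)
  have z0: "0 \<le> z" by (rule greatest) (simp add: S_def)
  have F: "a + b z z \<le> z"
  proof (rule greatest)
    fix v assume v: "v \<in> S"
    have "b z z \<le> b v v" using nonneg_bilinear_mono[OF b z0 lower[OF v] z0 lower[OF v]] .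
    then have "a + b z z \<le> a + b v v" by simp
    also have "\<dots> \<le> v" using v by (simp add: S_def)
    finally show "a + b z z \<le> v" .
  qed
  have F0: "0 \<le> a + b z z" using a nonneg_bilinear_nonneg[OF b z0 z0] by simp
  have "a + b z z \<in> S"
    using F0 nonneg_bilinear_mono[OF b F0 F F0 F] by (simp add: S_def)
  from lower[OF this] F have "qve_solution a b z" using z0 by (simp add: qve_solution_def)
  then have "m \<le> z" using m by (simp add: minimal_qve_solution_def)
  with lower[OF yS] show ?thesis by simp
qed

section \<open>Singularity of I - K for a nonnegative matrix K\<close>

text \<open>
  For a vector \<open>z\<close> with \<open>K z = z\<close>, let \<open>t\<close> be the largest ratio \<open>\<bar>z\<^sub>i\<bar> / x\<^sub>i\<close> and \<open>S\<close> the set where it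
  is attained. At \<open>i \<in> S\<close> the chain
  \<open>t x\<^sub>i = \<bar>z\<^sub>i\<bar> \<le> \<Sum>\<^sub>j K\<^sub>i\<^sub>j \<bar>z\<^sub>j\<bar> \<le> t \<Sum>\<^sub>j K\<^sub>i\<^sub>j x\<^sub>j = t (x\<^sub>i - w\<^sub>i) \<le> t x\<^sub>i\<close>
  must consist of equalities. This replaces a Perron eigenvector of \<open>K\<close>.
\<close>
lemma singular_imp_closed_index_set:
  fixes K :: "real^'m::finite^'m"
  assumes K: "\<And>i j. 0 \<le> K $ i $ j" and x: "\<And>i. 0 < x $ i" and w: "0 \<le> w"
    and eq: "x = w + K *v x" and sing: "\<not> invertible (mat 1 - K)"
  obtains S where "S \<noteq> {}" "\<And>i. i \<in> S \<Longrightarrow> w $ i = 0"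
    "\<And>i j. i \<in> S \<Longrightarrow> j \<notin> S \<Longrightarrow> K $ i $ j = 0"
proof -
  obtain z where z: "z \<noteq> 0" "(mat 1 - K) *v z = 0"
    using sing unfolding invertible_left_inverse matrix_left_invertible_ker by blast
  then have Kz: "K *v z = z" by (simp add: matrix_vector_mult_diff_rdistrib)
  define r where "r = (\<lambda>i. \<bar>z $ i\<bar> / x $ i)"
  define t where "t = Max (range r)"
  define S where "S = {i. r i = t}"
  have le_t: "r i \<le> t" for i by (simp add: t_def)
  have zt: "\<bar>z $ i\<bar> \<le> t * x $ i" for i
    using x[of i] le_t[of i] by (simp add: r_def pos_divide_le_eq)
  have "t \<in> range r" unfolding t_def by (rule Max_in) auto
  then have "S \<noteq> {}" by (auto simp: S_def)
  obtain i0 where "z $ i0 \<noteq> 0" using z(1) by (auto simp: vec_eq_iff)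
  then have "0 < r i0" using x[of i0] by (simp add: r_def)
  then have t: "0 < t" using le_t[of i0] by linarith
  have tight: "w $ i = 0 \<and> (\<forall>j. K $ i $ j * (t * x $ j - \<bar>z $ j\<bar>) = 0)" if i: "i \<in> S" for i
  proof -
    have "t * x $ i = \<bar>z $ i\<bar>" using i x[of i] by (auto simp: S_def r_def field_simps)
    also have "\<dots> = \<bar>\<Sum>j\<in>UNIV. K $ i $ j * z $ j\<bar>"
      using arg_cong[OF Kz, of "\<lambda>v. v $ i"] by (simp add: matrix_vector_mult_def)
    also have "\<dots> \<le> (\<Sum>j\<in>UNIV. K $ i $ j * \<bar>z $ j\<bar>)"
      using sum_abs[of "\<lambda>j. K $ i $ j * z $ j" UNIV] K by (simp add: abs_mult)
    finally have 1: "t * x $ i \<le> (\<Sum>j\<in>UNIV. K $ i $ j * \<bar>z $ j\<bar>)" .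
    have 2: "x $ i = w $ i + (\<Sum>j\<in>UNIV. K $ i $ j * x $ j)"
      using arg_cong[OF eq, of "\<lambda>v. v $ i"] by (simp add: matrix_vector_mult_def)
    have nn: "0 \<le> K $ i $ j * (t * x $ j - \<bar>z $ j\<bar>)" for j
      using K[of i j] zt[of j] by simp
    have "(\<Sum>j\<in>UNIV. K $ i $ j * (t * x $ j - \<bar>z $ j\<bar>))
        = t * (\<Sum>j\<in>UNIV. K $ i $ j * x $ j) - (\<Sum>j\<in>UNIV. K $ i $ j * \<bar>z $ j\<bar>)"
      by (simp add: right_diff_distrib sum_subtractf sum_distrib_left mult.left_commute)
    also have "\<dots> = t * x $ i - t * w $ i - (\<Sum>j\<in>UNIV. K $ i $ j * \<bar>z $ j\<bar>)"
      using 2 by (simp add: distrib_left)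
    finally have sum: "(\<Sum>j\<in>UNIV. K $ i $ j * (t * x $ j - \<bar>z $ j\<bar>)) + t * w $ i \<le> 0"
      using 1 by linarith
    have sum0: "0 \<le> (\<Sum>j\<in>UNIV. K $ i $ j * (t * x $ j - \<bar>z $ j\<bar>))"
      using nn by (simp add: sum_nonneg)
    have wi: "0 \<le> w $ i" using w by (simp add: less_eq_vec_def)
    then have tw: "0 \<le> t * w $ i" using t by simp
    have "t * w $ i = 0" "(\<Sum>j\<in>UNIV. K $ i $ j * (t * x $ j - \<bar>z $ j\<bar>)) = 0"
      using sum sum0 tw by linarith+
    then show ?thesis using t nn by (simp add: sum_nonneg_eq_0_iff)
  qed
  show thesis
  proof (rule that)
    show "S \<noteq> {}" by fact
    show "w $ i = 0" if "i \<in> S" for i using tight[OF that] by simp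
    show "K $ i $ j = 0" if "i \<in> S" "j \<notin> S" for i j
    proof -
      have "\<bar>z $ j\<bar> \<noteq> t * x $ j" using that(2) x[of j] by (auto simp: S_def r_def)
      then show ?thesis using tight[OF that(1)] by auto
    qed
  qed
qed

section \<open>The block decomposition\<close>

\<comment> \<open>The embeddings of the blocks stay in the form \<open>transpose P_mat *v u\<close> of their coordinate rules.\<close>
declare transpose_matrix_vector [simp del]

lemma P_mat_nth [simp]: "(P_mat *v x) $ i = x $ Inl i"
  by (simp add: P_mat_def matrix_vector_mult_def if_distrib[of "\<lambda>c. c * _"] cong: if_cong)

lemma Q_mat_nth [simp]: "(Q_mat *v x) $ i = x $ Inr i"
  by (simp add: Q_mat_def matrix_vector_mult_def if_distrib[of "\<lambda>c. c * _"] cong: if_cong)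

lemma transpose_P_mat_nth [simp]:
  "(transpose P_mat *v u) $ Inl i = u $ i" "(transpose P_mat *v u) $ Inr j = 0"
  by (simp_all add: P_mat_def transpose_def matrix_vector_mult_def if_distrib[of "\<lambda>c. c * _"]
      cong: if_cong)

lemma transpose_Q_mat_nth [simp]:
  "(transpose Q_mat *v u) $ Inl i = 0" "(transpose Q_mat *v u) $ Inr j = u $ j"
  by (simp_all add: Q_mat_def transpose_def matrix_vector_mult_def if_distrib[of "\<lambda>c. c * _"]
      cong: if_cong)

lemma block_le_iff: "x \<le> y \<longleftrightarrow> P_mat *v x \<le> P_mat *v y \<and> Q_mat *v x \<le> Q_mat *v y"
  by (simp add: less_eq_vec_def split_sum_all[of "\<lambda>k. x $ k \<le> y $ k"])

lemma block_eq_iff: "x = y \<longleftrightarrow> P_mat *v x = P_mat *v y \<and> Q_mat *v x = Q_mat *v y"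
  by (simp add: vec_eq_iff split_sum_all[of "\<lambda>k. x $ k = y $ k"])

lemma block_split: "transpose P_mat *v (P_mat *v x) + transpose Q_mat *v (Q_mat *v x) = x"
  by (simp add: block_eq_iff vec_eq_iff)

lemma block_glue [simp]:
  "P_mat *v (transpose P_mat *v u + transpose Q_mat *v v) = u"
  "Q_mat *v (transpose P_mat *v u + transpose Q_mat *v v) = v"
  by (simp_all add: vec_eq_iff)

lemma block_nonneg:
  "0 \<le> x \<Longrightarrow> 0 \<le> P_mat *v x" "0 \<le> x \<Longrightarrow> 0 \<le> Q_mat *v x"
  "0 \<le> u \<Longrightarrow> 0 \<le> transpose P_mat *v u" "0 \<le> v \<Longrightarrow> 0 \<le> transpose Q_mat *v v"
  by (auto simp: less_eq_vec_def split_sum_all[of "\<lambda>k. 0 \<le> (transpose P_mat *v u) $ k"]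
      split_sum_all[of "\<lambda>k. 0 \<le> (transpose Q_mat *v v) $ k"])

text \<open>
  Each entry of the lower left block of \<open>R\<close> is the sum of all the coefficients by which one
  first-block variable enters one second-block row; these are nonnegative, hence individually zero.
\<close>
lemma second_block_closed:
  fixes b :: "real^('m::finite + 'n::finite) \<Rightarrow> real^('m + 'n) \<Rightarrow> real^('m + 'n)"
  assumes b: "nonneg_bilinear b" and R: "\<forall>(i::'n) (j::'m). R_mat b $ Inr i $ Inl j = 0"
  shows "Q_mat *v b x y = b2_form b (Q_mat *v x) (Q_mat *v y)"
proof -
  have axis_le_1: "axis k 1 \<le> (1::real^('m + 'n))" and axis_nonneg: "0 \<le> (axis k 1::real^('m + 'n))"
    for k by (auto simp: less_eq_vec_def axis_def)
  have zero: "b (axis (Inl j) 1) (axis k 1) $ Inr i = 0 \<and> b (axis k 1) (axis (Inl j) 1) $ Inr i = 0"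
    for i j k
  proof -
    let ?j = "axis (Inl j) 1 :: real^('m + 'n)" and ?k = "axis k 1 :: real^('m + 'n)"
    have "b 1 ?j $ Inr i + b ?j 1 $ Inr i = 0"
      using R[rule_format, of i j] by (simp add: R_mat_def matrix_def)
    moreover have "0 \<le> b ?k ?j $ Inr i" "0 \<le> b ?j ?k $ Inr i"
      using b by (auto simp: nonneg_bilinear_def)
    moreover have "b ?k ?j $ Inr i \<le> b 1 ?j $ Inr i" "b ?j ?k $ Inr i \<le> b ?j 1 $ Inr i"
      using nonneg_bilinear_mono[OF b axis_nonneg[of k] axis_le_1 axis_nonneg order_refl, of "Inl j"]
        nonneg_bilinear_mono[OF b axis_nonneg order_refl axis_nonneg[of k] axis_le_1, of "Inl j"]
      by (auto simp: less_eq_vec_def)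
    ultimately show ?thesis by linarith
  qed
  let ?c = "\<lambda>i j k. b (axis j 1) (axis k 1) $ Inr i"
  let ?x = "transpose Q_mat *v (Q_mat *v x)" and ?y = "transpose Q_mat *v (Q_mat *v y)"
  note coord = bilinear_coordinates[OF nonneg_bilinearD[OF b]]
  have "b x y $ Inr i = b ?x ?y $ Inr i" for i
  proof -
    have "x $ j * y $ k * ?c i j k = ?x $ j * ?y $ k * ?c i j k" for j k
      using zero by (cases j; cases k) auto
    then have "(\<Sum>j\<in>UNIV. \<Sum>k\<in>UNIV. x $ j * y $ k * ?c i j k)
        = (\<Sum>j\<in>UNIV. \<Sum>k\<in>UNIV. ?x $ j * ?y $ k * ?c i j k)"
      by (intro sum.cong refl)
    from trans[OF trans[OF coord[of x y "Inr i"] this] coord[of ?x ?y "Inr i", symmetric]]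
    show ?thesis .
  qed
  then show ?thesis by (simp add: b2_form_def vec_eq_iff)
qed

section \<open>The reduced equation for the first block\<close>

text \<open>The terms of the first block that are linear in \<open>x\<^sub>1\<close>, so that \<open>T_mat b y = I - cross_mat b y\<close>.\<close>
definition cross_mat ::
    "(real^('m::finite + 'n::finite) \<Rightarrow> real^('m + 'n) \<Rightarrow> real^('m + 'n)) \<Rightarrow> real^'n \<Rightarrow> real^'m^'m" where
  "cross_mat b y = P_mat ** matrix (\<lambda>v. b v (transpose Q_mat *v y)) ** transpose P_mat
     + P_mat ** matrix (\<lambda>v. b (transpose Q_mat *v y) v) ** transpose P_mat"

lemma T_mat_eq: "T_mat b y = mat 1 - cross_mat b y"
  by (simp add: T_mat_def cross_mat_def)

lemma cross_mat_mult:
  assumes "bilinear b"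
  shows "cross_mat b y *v u
    = P_mat *v (b (transpose P_mat *v u) (transpose Q_mat *v y)
        + b (transpose Q_mat *v y) (transpose P_mat *v u))"
  using assms
  by (simp add: cross_mat_def matrix_vector_mult_add_rdistrib matrix_vector_right_distrib
      matrix_works bilinear_def flip: matrix_vector_mul_assoc)

lemma cross_mat_nonneg:
  assumes b: "nonneg_bilinear b" and y: "0 \<le> y"
  shows "0 \<le> cross_mat b y $ i $ j"
proof -
  have "0 \<le> (axis j 1 :: real^'a)" by (simp add: less_eq_vec_def axis_def)
  then have "0 \<le> cross_mat b y *v axis j 1"
    unfolding cross_mat_mult[OF nonneg_bilinearD[OF b]]
    using y by (intro block_nonneg add_nonneg_nonneg nonneg_bilinear_nonneg[OF b])
  then show ?thesis
    by (simp add: matrix_vector_mult_basis less_eq_vec_def column_def)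
qed

text \<open>The part of the first block that is not linear in the first-block variable \<open>u\<close>.\<close>
definition reduced_rhs ::
    "real^('m::finite + 'n::finite) \<Rightarrow> (real^('m + 'n) \<Rightarrow> real^('m + 'n) \<Rightarrow> real^('m + 'n)) \<Rightarrow>
     real^'n \<Rightarrow> real^'m \<Rightarrow> real^'m" where
  "reduced_rhs a b y u = P_mat *v a + P_mat *v b (transpose Q_mat *v y) (transpose Q_mat *v y)
     + P_mat *v b (transpose P_mat *v u) (transpose P_mat *v u)"

lemma first_block_eq:
  assumes "bilinear b"
  shows "P_mat *v (a + b x x)
    = reduced_rhs a b (Q_mat *v x) (P_mat *v x) + cross_mat b (Q_mat *v x) *v (P_mat *v x)"
proof -
  let ?p = "transpose P_mat *v (P_mat *v x)" and ?q = "transpose Q_mat *v (Q_mat *v x)"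
  have "b x x = b (?p + ?q) (?p + ?q)" by (simp add: block_split)
  also have "\<dots> = b ?p ?p + b ?p ?q + (b ?q ?p + b ?q ?q)"
    by (simp add: bilinear_ladd[OF assms] bilinear_radd[OF assms])
  finally show ?thesis
    by (simp add: reduced_rhs_def cross_mat_mult[OF assms] matrix_vector_right_distrib)
qed

lemma reduced_qve_iff:
  assumes "invertible (T_mat b y)"
  shows "u = a_red a b y + b_red b y u u \<longleftrightarrow> u = reduced_rhs a b y u + cross_mat b y *v u"
proof -
  let ?T = "T_mat b y"
  have inv: "?T ** matrix_inv ?T = mat 1" "matrix_inv ?T ** ?T = mat 1"
    using someI_ex[OF assms[unfolded invertible_def]] by (simp_all add: matrix_inv_def)
  have "a_red a b y + b_red b y u u = matrix_inv ?T *v reduced_rhs a b y u"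
    by (simp add: a_red_def b_red_def reduced_rhs_def matrix_vector_right_distrib)
  moreover have "u = matrix_inv ?T *v c \<longleftrightarrow> ?T *v u = c" for c
    using inv by (metis matrix_vector_mul_assoc matrix_vector_mul_lid)
  moreover have "?T *v u = c \<longleftrightarrow> u = c + cross_mat b y *v u" for c
    by (auto simp: T_mat_eq matrix_vector_mult_diff_rdistrib algebra_simps)
  ultimately show ?thesis by simp
qed

section \<open>Invertibility and the reduction\<close>

text \<open>
  If \<open>T\<close> were singular, the first-block coordinates in the set \<open>S\<close> of
  \<open>singular_imp_closed_index_set\<close> could be set to zero without spoiling \<open>a + b x x \<le> x\<close>:
  outside \<open>S\<close> the left-hand side only decreases, and on \<open>S\<close> all of its terms vanish.
\<close>
lemma T_mat_invertible:
  fixes a x xstar :: "real^('m::finite + 'n::finite)"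
  assumes a: "0 \<le> a" and b: "nonneg_bilinear b" and m: "minimal_qve_solution a b xstar"
    and pos: "\<forall>i. 0 < xstar $ i" and x: "qve_solution a b x"
  shows "invertible (T_mat b (Q_mat *v x))"
proof (rule ccontr)
  assume sing: "\<not> invertible (T_mat b (Q_mat *v x))"
  note bil = nonneg_bilinearD[OF b]
  let ?u = "P_mat *v x" and ?v = "Q_mat *v x"
  let ?K = "cross_mat b ?v" and ?w = "reduced_rhs a b ?v ?u"
  have x0: "0 \<le> x" and xeq: "x = a + b x x" using x by (simp_all add: qve_solution_def)
  have "xstar \<le> x" using m x by (simp add: minimal_qve_solution_def)
  then have xpos: "0 < x $ i" for i
    using pos by (meson less_eq_vec_def less_le_trans)
  have v0: "0 \<le> ?v" and u0: "0 \<le> ?u" using x0 by (simp_all add: block_nonneg)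
  have w0: "0 \<le> ?w" unfolding reduced_rhs_def
    using a x0 by (intro add_nonneg_nonneg block_nonneg nonneg_bilinear_nonneg[OF b])
  have ueq: "?u = ?w + ?K *v ?u" using first_block_eq[OF bil, of a x] xeq by simp
  obtain S where S: "S \<noteq> {}" and wS: "\<And>i. i \<in> S \<Longrightarrow> ?w $ i = 0"
    and KS: "\<And>i j. i \<in> S \<Longrightarrow> j \<notin> S \<Longrightarrow> ?K $ i $ j = 0"
    using singular_imp_closed_index_set[of ?K ?u ?w, OF cross_mat_nonneg[OF b v0] _ w0 ueq]
      sing xpos by (auto simp: T_mat_eq)
  define u' where "u' = (\<chi> i. if i \<in> S then 0 else ?u $ i)"
  define y where "y = transpose P_mat *v u' + transpose Q_mat *v ?v"
  have Py: "P_mat *v y = u'" and Qy: "Q_mat *v y = ?v" by (simp_all add: y_def)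
  have u'0: "0 \<le> u'" and u'u: "u' \<le> ?u"
    using x0 by (auto simp: u'_def less_eq_vec_def)
  have y0: "0 \<le> y" and yx: "y \<le> x"
    using u'0 u'u v0 by (simp_all add: block_le_iff Py Qy)
  have le: "a + b y y \<le> x"
    using nonneg_bilinear_mono[OF b y0 yx y0 yx] xeq by (metis add_left_mono)
  have onS: "(a + b y y) $ Inl i \<le> 0" if i: "i \<in> S" for i
  proof -
    have "transpose P_mat *v u' \<le> (transpose P_mat *v ?u :: real^('m + 'n))"
      using block_nonneg(3)[of "?u - u'"] u'u by (simp add: matrix_vector_mult_diff_distrib)
    then have "b (transpose P_mat *v u') (transpose P_mat *v u')
        \<le> b (transpose P_mat *v ?u) (transpose P_mat *v ?u)"
      using u'0 by (intro nonneg_bilinear_mono[OF b] block_nonneg)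
    then have "reduced_rhs a b ?v u' $ i \<le> ?w $ i"
      by (simp add: reduced_rhs_def less_eq_vec_def)
    moreover have "(?K *v u') $ i = 0"
      using KS[OF i] by (auto simp: matrix_vector_mult_def u'_def intro!: sum.neutral)
    moreover have "(a + b y y) $ Inl i = reduced_rhs a b ?v u' $ i + (?K *v u') $ i"
      using arg_cong[OF first_block_eq[OF bil, of a y], of "\<lambda>v. v $ i"] by (simp add: Py Qy)
    ultimately show ?thesis using wS[OF i] by simp
  qed
  have "a + b y y \<le> y"
    unfolding less_eq_vec_def
  proof
    fix k
    show "(a + b y y) $ k \<le> y $ k"
    proof (cases k)
      case (Inl i)
      then show ?thesis
        using onS[of i] le by (auto simp: y_def u'_def less_eq_vec_def)
    next
      case (Inr j)
      then show ?thesis using le by (auto simp: y_def less_eq_vec_def)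
    qed
  qed
  then have "xstar \<le> y" using minimal_qve_solution_le_supersolution[OF a b m y0] by simp
  moreover obtain i where "i \<in> S" using S by auto
  ultimately have "xstar $ Inl i \<le> 0" by (auto simp: less_eq_vec_def y_def u'_def dest: spec[of _ "Inl i"])
  then show False using pos by (meson not_less)
qed

lemma qve_solution_iff_blocks:
  fixes a x :: "real^('m::finite + 'n::finite)"
  assumes b: "nonneg_bilinear b" and R: "\<forall>(i::'n) (j::'m). R_mat b $ Inr i $ Inl j = 0"
    and inv: "invertible (T_mat b (Q_mat *v x))"
  shows "qve_solution a b x \<longleftrightarrow>
    qve_solution (Q_mat *v a) (b2_form b) (Q_mat *v x) \<and>
    qve_solution (a_red a b (Q_mat *v x)) (b_red b (Q_mat *v x)) (P_mat *v x)"
proof -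
  have "x = a + b x x \<longleftrightarrow>
      P_mat *v x = P_mat *v (a + b x x) \<and> Q_mat *v x = Q_mat *v a + Q_mat *v b x x"
    using block_eq_iff[of x "a + b x x"] by (simp add: matrix_vector_right_distrib)
  moreover have "0 \<le> x \<longleftrightarrow> 0 \<le> P_mat *v x \<and> 0 \<le> Q_mat *v x"
    using block_le_iff[of 0 x] by simp
  ultimately show ?thesis
    unfolding qve_solution_def reduced_qve_iff[OF inv] first_block_eq[OF nonneg_bilinearD[OF b]]
      second_block_closed[OF b R]
    by blast
qed

text \<open>
  A solution \<open>v\<close> of the second-block equation gives the supersolution \<open>(1, min 1 v)\<close> of the full
  equation: the truncation keeps it below the solution \<open>1\<close>, which takes care of the first block.
\<close>
lemma second_block_minimal:
  fixes a xstar :: "real^('m::finite + 'n::finite)"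
  assumes a: "0 \<le> a" and b: "nonneg_bilinear b" and e: "1 = a + b 1 1"
    and m: "minimal_qve_solution a b xstar"
    and R: "\<forall>(i::'n) (j::'m). R_mat b $ Inr i $ Inl j = 0"
    and v: "qve_solution (Q_mat *v a) (b2_form b) v"
  shows "Q_mat *v xstar \<le> v"
proof -
  have v0: "0 \<le> v" and veq: "v = Q_mat *v a + b2_form b v v"
    using v by (simp_all add: qve_solution_def)
  define y :: "real^('m + 'n)" where
    "y = transpose P_mat *v 1 + transpose Q_mat *v (\<chi> j. min 1 (v $ j))"
  define y' :: "real^('m + 'n)" where "y' = transpose P_mat *v 1 + transpose Q_mat *v v"
  have Qy': "Q_mat *v y' = v" by (simp add: y'_def)
  have y0: "0 \<le> y" and y1: "y \<le> 1" and yy': "y \<le> y'"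
    using v0 by (auto simp: y_def y'_def block_le_iff less_eq_vec_def)
  have le1: "a + b y y \<le> 1"
    using nonneg_bilinear_mono[OF b y0 y1 y0 y1] e by (metis add_left_mono)
  have "a + b y y \<le> a + b y' y'"
    using nonneg_bilinear_mono[OF b y0 yy' y0 yy'] by simp
  then have "Q_mat *v (a + b y y) \<le> Q_mat *v (a + b y' y')" by (simp add: block_le_iff)
  also have "\<dots> = v"
    using veq by (simp add: matrix_vector_right_distrib second_block_closed[OF b R] Qy')
  finally have lev: "Q_mat *v (a + b y y) \<le> v" .
  have "a + b y y \<le> y"
    unfolding less_eq_vec_def
  proof
    fix k
    show "(a + b y y) $ k \<le> y $ k"
      using le1 lev by (cases k) (auto simp: y_def less_eq_vec_def)
  qed
  then have "xstar \<le> y" using minimal_qve_solution_le_supersolution[OF a b m y0] by simp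
  also note yy'
  finally show ?thesis by (simp add: block_le_iff Qy')
qed

theorem theorem1:
  fixes a xstar :: "real^('m::finite + 'n::finite)"
    and b :: "real^('m + 'n) \<Rightarrow> real^('m + 'n) \<Rightarrow> real^('m + 'n)"
  assumes "0 \<le> a"
    and "nonneg_bilinear b"
    and "1 = a + b 1 1"
    and "minimal_qve_solution a b xstar"
    and "\<forall>i. 0 < xstar $ i"
    and "\<forall>(i::'n) (j::'m). R_mat b $ Inr i $ Inl j = 0"
  shows "(\<forall>x. 0 \<le> x \<longrightarrow>
            (qve_solution a b x \<longleftrightarrow>
               invertible (T_mat b (Q_mat *v x)) \<and>
               qve_solution (Q_mat *v a) (b2_form b) (Q_mat *v x) \<and>
               qve_solution (a_red a b (Q_mat *v x)) (b_red b (Q_mat *v x)) (P_mat *v x)))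
       \<and> minimal_qve_solution (Q_mat *v a) (b2_form b) (Q_mat *v xstar)
       \<and> minimal_qve_solution (a_red a b (Q_mat *v xstar)) (b_red b (Q_mat *v xstar))
           (P_mat *v xstar)"
proof -
  note a = assms(1) and b = assms(2) and e = assms(3) and m = assms(4) and pos = assms(5)
    and R = assms(6)
  let ?u = "P_mat *v xstar" and ?v = "Q_mat *v xstar"
  have star: "qve_solution a b xstar" using m by (simp add: minimal_qve_solution_def)
  note inv = T_mat_invertible[OF a b m pos]
  note blocks = qve_solution_iff_blocks[OF b R]
  have first_minimal: "?u \<le> u" if u: "qve_solution (a_red a b ?v) (b_red b ?v) u" for u
  proof -
    define x where "x = transpose P_mat *v u + transpose Q_mat *v ?v"
    have Px: "P_mat *v x = u" and Qx: "Q_mat *v x = ?v" by (simp_all add: x_def)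
    have "qve_solution a b x"
      using blocks[of x a] blocks[OF inv[OF star], of a] inv[OF star] star u by (simp add: Px Qx)
    then have "xstar \<le> x" using m by (simp add: minimal_qve_solution_def)
    then show ?thesis by (simp add: block_le_iff Px)
  qed
  show ?thesis
    using inv blocks blocks[OF inv[OF star], of a] star first_minimal
      second_block_minimal[OF a b e m R]
    unfolding minimal_qve_solution_def by blast
qed

end
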